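(* Let $q$ be a prime power, let $\varepsilon>0$, let $n\ge1$, and let $A_n$ be chosen uniformly from $\operatorname{GL}_n(\mathbf{F}_q)$. Let $n'\ge 1$ be an integer with $n'\le(1-\varepsilon)n$ and let $M_{n'}$ be the top left $n'\times n'$ corner of $A_n$. Then $$\|Q(M_{n'})-Q_\infty\|_{TV}\le\frac{3}{q^{n'}}+\frac{2^{\min(n',\varepsilon n)+1}}{q^{\varepsilon n}}.$$
   Context: For an $n'\times n'$ matrix $M$, $Q(M)=n'-\operatorname{rank}(M)$. $Q_\infty$ is the random variable on $\{0,1,2,\dots\}$ with $$\mathbf{P}(Q_\infty=k)=\frac{1}{q^{k^2}}\frac{\prod_{i=k+1}^\infty(1-1/q^i)}{\prod_{i=1}^k(1-1/q^i)}.$$ $\|\cdot-\cdot\|_{TV}$ is the total variation distance between distributions. *)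

theory Defs
  imports
    "HOL-Probability.Probability"
    "Jordan_Normal_Form.DL_Rank"
begin

section \<open>Invertible matrices and corners\<close>

definition GL :: "nat \<Rightarrow> 'a::field mat set" where
  "GL n = {A \<in> carrier_mat n n. invertible_mat A}"

definition corner :: "nat \<Rightarrow> 'a mat \<Rightarrow> 'a mat" where
  "corner m A = mat m m (\<lambda>(i, j). A $$ (i, j))"

text \<open>Only meant for square matrices, where the truncated subtraction is exact.\<close>
definition corank :: "'a::field mat \<Rightarrow> nat" where
  "corank M = dim_row M - vec_space.rank (dim_row M) M"

lemma one_mat_in_GL: "1\<^sub>m n \<in> GL n"
  unfolding GL_def invertible_mat_def inverts_mat_def
  by (auto intro!: exI[of _ "1\<^sub>m n"])

lemma GL_nonempty: "GL n \<noteq> {}"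
  using one_mat_in_GL by blast

lemma finite_GL: "finite (GL n :: 'a::{finite,field} mat set)"
proof (rule finite_subset)
  let ?S = "{f :: nat \<times> nat \<Rightarrow> 'a. \<forall>p. (p \<in> {..<n} \<times> {..<n} \<longrightarrow> f p \<in> UNIV) \<and>
    (p \<notin> {..<n} \<times> {..<n} \<longrightarrow> f p = 0)}"
  show "finite (mat n n ` ?S)"
    by (intro finite_imageI finite_set_of_finite_funs) auto
  show "GL n \<subseteq> mat n n ` ?S"
  proof
    fix A :: "'a mat" assume "A \<in> GL n"
    then have A: "A \<in> carrier_mat n n" by (simp add: GL_def)
    let ?f = "\<lambda>p. if p \<in> {..<n} \<times> {..<n} then A $$ p else 0"
    have "A = mat n n ?f" using A by (intro eq_matI) auto
    moreover have "?f \<in> ?S" by auto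
    ultimately show "A \<in> mat n n ` ?S" by blast
  qed
qed

section \<open>Total variation distance\<close>

definition tv_dist :: "'a pmf \<Rightarrow> 'a pmf \<Rightarrow> real" where
  "tv_dist X Y = (SUP B. \<bar>measure_pmf.prob X B - measure_pmf.prob Y B\<bar>)"

section \<open>The limiting corank distribution\<close>

definition Q_infty_mass :: "nat \<Rightarrow> nat \<Rightarrow> real" where
  "Q_infty_mass q k =
     1 / real q ^ (k ^ 2) *
     ((\<Prod>i. 1 - 1 / real q ^ (k + 1 + i)) / (\<Prod>i = 1..k. 1 - 1 / real q ^ i))"

definition Q_infty :: "nat \<Rightarrow> nat pmf" where
  "Q_infty q = embed_pmf (Q_infty_mass q)"

text \<open>
  For \<open>q \<ge> 2\<close> the masses are nonnegative and sum to 1, so that \<open>Q_infty q\<close> really is the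
  distribution with these point masses. With \<open>x = 1 / q\<close>, this is the case \<open>a = 0\<close> of
  \<open>(\<Sum>k. x ^ (k * (k + a)) / (ph k * ph (k + a))) = 1 / P\<close>, where \<open>ph n\<close> is the product of
  the \<open>1 - x ^ i\<close> with \<open>1 \<le> i \<le> n\<close> and \<open>P\<close> is its limit. The differences
  of the left-hand side for \<open>a\<close> and \<open>a + 1\<close> satisfy a recurrence which forces them to vanish,
  and the limit for large \<open>a\<close> is immediate.
\<close>

context
  fixes x :: real and ph :: "nat \<Rightarrow> real" and P :: real and T :: "nat \<Rightarrow> nat \<Rightarrow> real"
  assumes x: "0 < x" "x < 1"
  defines "ph \<equiv> (\<lambda>n. \<Prod>i = 1..n. 1 - x ^ i)"
    and "P \<equiv> (\<Prod>i. 1 - x ^ Suc i)"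
    and "T \<equiv> (\<lambda>a k. x ^ (k * (k + a)) / (ph k * ph (k + a)))"
begin

private lemma squeeze_zero:
  fixes f g :: "nat \<Rightarrow> real"
  assumes "\<And>n. 0 \<le> f n" "\<And>n. f n \<le> g n" "g \<longlonglongrightarrow> 0"
  shows "f \<longlonglongrightarrow> 0"
  using assms by (intro real_tendsto_sandwich[of "\<lambda>_. 0" f sequentially g 0]) simp_all

private lemma xpow: "x ^ Suc i < 1" "0 < x ^ i"
  using x power_Suc_less_one[of x i] by auto

private lemma conv: "convergent_prod (\<lambda>i. 1 - x ^ Suc i)"
proof -
  have "summable (\<lambda>i. x ^ Suc i)"
    using x by (subst summable_Suc_iff) (intro summable_geometric; simp)
  then have "abs_convergent_prod (\<lambda>i. 1 + (- (x ^ Suc i)))"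
    using x by (intro summable_imp_abs_convergent_prod) simp
  then show ?thesis using abs_convergent_prod_imp_convergent_prod by fastforce
qed

private lemma ph_altdef: "ph n = (\<Prod>i<n. 1 - x ^ Suc i)"
  unfolding ph_def by (simp add: prod.atLeast1_atMost_eq)

private lemma ph_Suc: "ph (Suc n) = ph n * (1 - x ^ Suc n)"
  by (simp add: ph_altdef)

private lemma ph_pos: "0 < ph n"
  unfolding ph_altdef using xpow by (intro prod_pos) simp

private lemma P_pos: "0 < P"
  unfolding P_def using xpow by (intro less_0_prodinf conv) simp

private lemma ph_lim: "ph \<longlonglongrightarrow> P"
proof -
  have "(\<lambda>n. \<Prod>i\<le>n. 1 - x ^ Suc i) \<longlonglongrightarrow> P"
    unfolding P_def by (rule convergent_prod_LIMSEQ[OF conv])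
  then have "(\<lambda>n. ph (Suc n)) \<longlonglongrightarrow> P"
    by (simp add: ph_altdef lessThan_Suc_atMost)
  then show ?thesis by (rule LIMSEQ_imp_Suc)
qed

private lemma P_le_ph: "P \<le> ph n"
proof -
  have "decseq ph"
  proof (rule decseq_SucI)
    fix n show "ph (Suc n) \<le> ph n"
      unfolding ph_Suc using ph_pos[of n] xpow(2)[of "Suc n"]
      by (intro mult_left_le) auto
  qed
  then show ?thesis using ph_lim decseq_ge by blast
qed

private lemma T_nonneg: "0 \<le> T a k"
  unfolding T_def using x ph_pos by (intro divide_nonneg_pos) auto

private lemma T_le:
  assumes "e \<le> k * (k + a)"
  shows "T a k \<le> x ^ e / (P * P)"
  unfolding T_def
proof (rule frac_le)
  show "x ^ (k * (k + a)) \<le> x ^ e" using assms x by (intro power_decreasing) auto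
  show "P * P \<le> ph k * ph (k + a)"
    using P_le_ph P_pos ph_pos[of k] by (intro mult_mono) auto
qed (use P_pos x in auto)

private lemma geo: "summable (\<lambda>k. x ^ (k + c) / (P * P))"
  using x by (simp add: power_add summable_mult2 summable_divide summable_geometric)

private lemma T_summable: "summable (T a)"
proof (rule summable_comparison_test'[of _ 0])
  show "norm (T a k) \<le> x ^ (k + 0) / (P * P)" for k
    using T_nonneg[of a k] T_le[of "k + 0" k a] by (cases k) auto
qed (rule geo)

private definition D :: "nat \<Rightarrow> real" where
  "D a = suminf (T a) - suminf (T (Suc a))"

private lemma D_sums: "(\<lambda>k. T a k - T (Suc a) k) sums D a"
  unfolding D_def by (intro sums_diff summable_sums T_summable)

private lemma T_diff: "T a k - T (Suc a) k =
    x ^ (k * (k + a)) * (1 - x ^ k - x ^ Suc (k + a)) / (ph k * ph (Suc (k + a)))"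
proof -
  have ne: "ph k \<noteq> 0" "ph (k + a) \<noteq> 0" "1 - x ^ Suc (k + a) \<noteq> 0"
    using ph_pos[of k] ph_pos[of "k + a"] xpow(1)[of "k + a"] by linarith+
  have e: "x ^ (k * Suc (k + a)) = x ^ (k * (k + a)) * x ^ k"
    by (simp flip: power_add add: algebra_simps)
  have "T a k = x ^ (k * (k + a)) * (1 - x ^ Suc (k + a)) / (ph k * ph (Suc (k + a)))"
    unfolding T_def ph_Suc using ne by (simp only: divide_simps) simp
  moreover have "T (Suc a) k = x ^ (k * (k + a)) * x ^ k / (ph k * ph (Suc (k + a)))"
    unfolding T_def by (simp only: add_Suc_right e)
  ultimately show ?thesis by (simp only: diff_divide_distrib[symmetric]) (simp add: algebra_simps)
qed

private lemma D_rec: "D a = - (x ^ Suc a) * D (Suc a)"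
proof -
  define U where "U k = x ^ (k * (k + a)) * (1 - x ^ k) / (ph k * ph (Suc (k + a)))" for k
  define V where "V k = x ^ (k * (k + a)) * x ^ Suc (k + a) / (ph k * ph (Suc (k + a)))" for k
  have TUV: "T a k - T (Suc a) k = U k - V k" for k
    unfolding T_diff U_def V_def by (simp only: diff_divide_distrib[symmetric] right_diff_distrib)
  have U_Suc: "U (Suc k) =
      x ^ Suc a * (x ^ (k * (k + Suc a)) * x ^ k) / (ph k * ph (Suc (k + Suc a)))" for k
  proof -
    have "Suc k * (Suc k + a) = Suc a + (k * (k + Suc a) + k)" by (simp add: algebra_simps)
    then have e: "x ^ (Suc k * (Suc k + a)) = x ^ Suc a * (x ^ (k * (k + Suc a)) * x ^ k)"
      by (simp only: power_add)
    have ne: "1 - x ^ Suc k \<noteq> 0"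
      using xpow(1)[of k] by linarith
    have cancel: "A * c / (p * c * r) = A / (p * r)" if "c \<noteq> 0" for A c p r :: real
      using that by (simp add: divide_simps)
    show ?thesis unfolding U_def e ph_Suc[of k] cancel[OF ne] by (simp only: add_Suc add_Suc_right)
  qed
  have V_alt: "V k = x ^ Suc a * (x ^ (k * (k + Suc a)) * (1 - x ^ Suc (k + Suc a))) /
      (ph k * ph (Suc (k + Suc a)))" for k
  proof -
    have "k * (k + a) + Suc (k + a) = Suc a + k * (k + Suc a)" by (simp add: algebra_simps)
    then have e: "x ^ (k * (k + a)) * x ^ Suc (k + a) = x ^ Suc a * x ^ (k * (k + Suc a))"
      by (simp only: power_add[symmetric])
    have ne: "1 - x ^ Suc (k + Suc a) \<noteq> 0"
      using xpow(1)[of "k + Suc a"] by linarith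
    have cancel: "A * B / (p * r) = A * (B * c) / (p * (r * c))" if "c \<noteq> 0" for A B c p r :: real
      using that by (simp add: divide_simps)
    show ?thesis unfolding V_def e ph_Suc[of "k + Suc a"]
      unfolding add_Suc_right by (rule cancel[OF ne[unfolded add_Suc_right]])
  qed
  have UV: "U (Suc k) - V k = - (x ^ Suc a) * (T (Suc a) k - T (Suc (Suc a)) k)" for k
    unfolding U_Suc V_alt T_diff
    by (simp only: diff_divide_distrib[symmetric] times_divide_eq_right)
       (simp add: algebra_simps)
  have "(\<lambda>k. U (Suc k) - V k) sums (- (x ^ Suc a) * D (Suc a))"
    unfolding UV by (intro sums_mult D_sums)
  moreover have "(\<lambda>k. U k - V k) sums D a"
    using D_sums[of a] by (simp add: TUV)
  ultimately have "(\<lambda>k. (U (Suc k) - V k) - (U k - V k)) sums (- (x ^ Suc a) * D (Suc a) - D a)"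
    by (rule sums_diff)
  then have "(\<lambda>k. U (Suc k) - U k) sums (- (x ^ Suc a) * D (Suc a) - D a)"
    by simp
  moreover have "(\<lambda>k. U (Suc k) - U k) sums (0 - U 0)"
  proof (rule telescope_sums)
    have "U k \<le> x ^ k / (P * P)" "0 \<le> U k" for k
    proof -
      have p: "0 < ph k * ph (Suc (k + a))" using ph_pos by simp
      have "k \<le> k * (k + a)" by (cases k) auto
      then have "x ^ (k * (k + a)) \<le> x ^ k" using x by (intro power_decreasing) auto
      moreover have "0 \<le> 1 - x ^ k" using x by (simp add: power_le_one)
      moreover have "1 - x ^ k \<le> 1" using x by simp
      ultimately have "x ^ (k * (k + a)) * (1 - x ^ k) \<le> x ^ k * 1"
        using x by (intro mult_mono) auto
      moreover have "P * P \<le> ph k * ph (Suc (k + a))"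
        using P_le_ph P_pos ph_pos[of k] by (intro mult_mono) auto
      ultimately show "U k \<le> x ^ k / (P * P)"
        unfolding U_def using P_pos x by (intro frac_le) auto
      show "0 \<le> U k" unfolding U_def using p x \<open>0 \<le> 1 - x ^ k\<close> by simp
    qed
    moreover have "(\<lambda>k. x ^ k / (P * P)) \<longlonglongrightarrow> 0"
      using summable_LIMSEQ_zero[OF geo[of 0]] by simp
    ultimately show "U \<longlonglongrightarrow> 0"
      by (intro squeeze_zero[of U "\<lambda>k. x ^ k / (P * P)"])
  qed
  moreover have "U 0 = 0" by (simp add: U_def)
  ultimately show ?thesis using sums_unique2 by fastforce
qed

private lemma T_suminf_bounds: "0 \<le> suminf (T a)" "suminf (T a) \<le> (\<Sum>k. x ^ (k + 0) / (P * P))"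
proof -
  show "0 \<le> suminf (T a)" by (intro suminf_nonneg T_summable T_nonneg)
  have "T a k \<le> x ^ (k + 0) / (P * P)" for k
    by (rule T_le) (cases k; auto)
  then show "suminf (T a) \<le> (\<Sum>k. x ^ (k + 0) / (P * P))"
    by (intro suminf_le T_summable geo)
qed

private lemma D_zero: "D a = 0"
proof -
  define C where "C = (\<Sum>k. x ^ (k + 0) / (P * P))"
  have bound: "\<bar>D a\<bar> \<le> C" for a
    unfolding D_def C_def using T_suminf_bounds[of a] T_suminf_bounds[of "Suc a"] by linarith
  have "\<bar>D a\<bar> \<le> x ^ N * C" for a N
  proof (induction N arbitrary: a)
    case 0 then show ?case using bound by simp
  next
    case (Suc N)
    have "\<bar>D a\<bar> = x ^ Suc a * \<bar>D (Suc a)\<bar>"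
      using x by (subst D_rec) (simp add: abs_mult)
    also have "\<dots> \<le> x ^ 1 * (x ^ N * C)"
      using x Suc by (intro mult_mono power_decreasing) auto
    finally show ?case by simp
  qed
  moreover have "(\<lambda>N. x ^ N * C) \<longlonglongrightarrow> 0"
    using x by (intro tendsto_mult_left_zero LIMSEQ_realpow_zero) auto
  ultimately have "\<bar>D a\<bar> \<le> 0"
    by (intro tendsto_lowerbound[of _ 0 sequentially]) auto
  then show ?thesis by simp
qed

private lemma T_suminf: "suminf (T 0) = 1 / P"
proof -
  have const: "suminf (T a) = suminf (T 0)" for a
    by (induction a) (use D_zero in \<open>auto simp: D_def\<close>)
  define C where "C = (\<Sum>k. x ^ (k + 1) / (P * P))"
  have split: "suminf (T a) = 1 / ph a + (\<Sum>k. T a (Suc k))" for a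
    using suminf_split_head[OF T_summable, of a] by (simp add: T_def ph_def)
  have tail: "0 \<le> (\<Sum>k. T a (Suc k))" "(\<Sum>k. T a (Suc k)) \<le> x ^ a * C" for a
  proof -
    have s: "summable (\<lambda>k. T a (Suc k))" using T_summable summable_Suc_iff by blast
    then show "0 \<le> (\<Sum>k. T a (Suc k))" by (intro suminf_nonneg T_nonneg)
    have "T a (Suc k) \<le> x ^ a * (x ^ (k + 1) / (P * P))" for k
      using T_le[of "a + (k + 1)" "Suc k" a] by (simp add: power_add mult_ac)
    then have "(\<Sum>k. T a (Suc k)) \<le> (\<Sum>k. x ^ a * (x ^ (k + 1) / (P * P)))"
      by (intro suminf_le s summable_mult geo)
    also have "\<dots> = x ^ a * C" unfolding C_def by (rule suminf_mult[OF geo])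
    finally show "(\<Sum>k. T a (Suc k)) \<le> x ^ a * C" .
  qed
  have "(\<lambda>a. x ^ a * C) \<longlonglongrightarrow> 0"
    using x by (intro tendsto_mult_left_zero LIMSEQ_realpow_zero) auto
  then have "(\<lambda>a. \<Sum>k. T a (Suc k)) \<longlonglongrightarrow> 0"
    by (rule squeeze_zero[OF tail])
  then have "(\<lambda>a. 1 / ph a + (\<Sum>k. T a (Suc k))) \<longlonglongrightarrow> 1 / P + 0"
    using P_pos by (intro tendsto_intros ph_lim) auto
  moreover have "1 / ph a + (\<Sum>k. T a (Suc k)) = suminf (T 0)" for a
    using split[of a] const[of a] by argo
  ultimately have "(\<lambda>a. suminf (T 0)) \<longlonglongrightarrow> 1 / P"
    by simp
  then show ?thesis using LIMSEQ_unique tendsto_const by blast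
qed

private lemma tail_prod: "(\<Prod>i. 1 - x ^ (k + 1 + i)) = P / ph k"
proof -
  have "1 - x ^ Suc i \<noteq> 0" for i using xpow(1)[of i] by linarith
  then have "P = (\<Prod>i. 1 - x ^ Suc (i + k)) * (\<Prod>i<k. 1 - x ^ Suc i)"
    unfolding P_def by (intro prodinf_split_initial_segment conv) auto
  then have "P = (\<Prod>i. 1 - x ^ (k + 1 + i)) * ph k"
    by (simp add: ph_altdef add.commute)
  then show ?thesis using ph_pos[of k] by (simp add: field_simps)
qed

lemma q_series_mass_sums:
  "(\<lambda>k. x ^ (k ^ 2) * ((\<Prod>i. 1 - x ^ (k + 1 + i)) / (\<Prod>i = 1..k. 1 - x ^ i))) sums 1"
  (is "?f sums 1")
  and q_series_mass_nonneg:
  "0 \<le> x ^ (k ^ 2) * ((\<Prod>i. 1 - x ^ (k + 1 + i)) / (\<Prod>i = 1..k. 1 - x ^ i))"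
proof -
  have eq: "?f k = P * T 0 k" for k
    unfolding tail_prod T_def by (simp add: power2_eq_square ph_def)
  have "(\<lambda>k. P * T 0 k) sums (P * (1 / P))"
    using summable_sums[OF T_summable[of 0]] by (intro sums_mult) (simp add: T_suminf)
  then show "?f sums 1" unfolding eq using P_pos by simp
  show "0 \<le> ?f k" unfolding eq using P_pos T_nonneg[of 0 k] by simp
qed

end

lemma pmf_Q_infty:
  assumes "q \<ge> 2"
  shows "pmf (Q_infty q) k = Q_infty_mass q k"
proof -
  have x: "0 < 1 / real q" "1 / real q < 1" using assms by auto
  have eq: "Q_infty_mass q = (\<lambda>k. (1 / real q) ^ (k ^ 2) *
      ((\<Prod>i. 1 - (1 / real q) ^ (k + 1 + i)) / (\<Prod>i = 1..k. 1 - (1 / real q) ^ i)))"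
    unfolding Q_infty_mass_def power_one_over ..
  have nonneg: "0 \<le> Q_infty_mass q k" for k
    unfolding eq by (rule q_series_mass_nonneg[OF x])
  have sums: "Q_infty_mass q sums 1"
    unfolding eq by (rule q_series_mass_sums[OF x])
  have "(\<integral>\<^sup>+ k. ennreal (Q_infty_mass q k) \<partial>count_space UNIV) = ennreal 1"
    using suminf_ennreal_eq[OF nonneg sums] by (simp add: nn_integral_count_space_nat)
  then show ?thesis
    unfolding Q_infty_def using nonneg by (intro pmf_embed_pmf) auto
qed

end

theory Submission
  imports Defs
begin

text \<open>
  Write \<open>m\<close> for the size of the corner, \<open>d = n - m\<close>, \<open>x = 1 / q\<close>, and \<open>ph i\<close> for the product
  of the \<open>1 - x ^ j\<close> with \<open>1 \<le> j \<le> i\<close>, with limit \<open>P\<close>. The corank of the corner has an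
  explicit distribution, symmetric in \<open>m\<close> and \<open>d\<close>: it takes the value \<open>k\<close> with probability
  \<open>x ^ k\<^sup>2 * ph m ^ 2 * ph d ^ 2 / (ph k ^ 2 * ph (m - k) * ph (d - k) * ph (m + d))\<close>
  if \<open>k \<le> min m d\<close>, and \<open>0\<close> otherwise (\<open>pmf_corank_corner_GL\<close>).

  To see this, note that the upper \<open>m\<close> rows of an invertible matrix form an \<open>m \<times> n\<close> matrix of
  rank \<open>m\<close>, and each such rectangle can be completed to an invertible matrix in the same number of
  ways (\<open>card_GL_corner\<close>). The upper rectangle of a random invertible matrix is therefore uniform
  among the rectangles of rank \<open>m\<close>. These are counted by choosing the \<open>m\<close> columns of a corner of
  rank \<open>m - k\<close>, and then \<open>d\<close> further columns that raise the rank to \<open>m\<close>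
  (\<open>card_full_rank_mats_corank\<close>). Both counts are instances of \<open>card_extensions\<close>, which adds one
  vector at a time: a vector keeps the rank \<open>r\<close> exactly if it is one of the \<open>q ^ r\<close> vectors of the
  span. This recurrence is Pascal's rule for Gaussian binomial coefficients.

  The limit distribution has mass \<open>x ^ k\<^sup>2 * P / ph k ^ 2\<close> at \<open>k\<close>. Since \<open>ph\<close> decreases,
  \<open>ph m \<le> ph (m - k)\<close> and \<open>ph d \<le> ph (d - k)\<close>, so that the ratio of the two masses is at most
  \<open>ph m * ph d / (ph (m + d) * P)\<close>, uniformly in \<open>k\<close>. For \<open>x \<le> 1 / 2\<close> the tail estimate
  \<open>qpoch_add_ge\<close> bounds this by \<open>1 / ((1 - x ^ m) * (1 - x ^ d))\<close>. A uniform bound \<open>1 + \<delta>\<close> on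
  the ratio of masses bounds the total variation distance by \<open>\<delta>\<close> (\<open>tv_dist_le\<close>), because the
  differences on a set and on its complement are opposite. This gives the distance bound
  \<open>3 * (x ^ m + x ^ d)\<close>. The claim is weaker: its second term is nonincreasing in \<open>\<epsilon> * n \<le> d\<close>, and
  for \<open>\<epsilon> * n = d\<close> it is at least \<open>4 * x ^ d\<close>.
\<close>

section \<open>Finite q-products\<close>

text \<open>The q-Pochhammer symbol \<open>(x; x)\<^sub>n\<close>.\<close>
definition qpoch :: "real \<Rightarrow> nat \<Rightarrow> real" where
  "qpoch x n = (\<Prod>i = 1..n. 1 - x ^ i)"

lemma qpoch_0 [simp]: "qpoch x 0 = 1"
  by (simp add: qpoch_def)

lemma qpoch_Suc: "qpoch x (Suc n) = qpoch x n * (1 - x ^ Suc n)"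
  by (simp add: qpoch_def)

lemma qpoch_pos:
  assumes "0 < x" "x < 1"
  shows "0 < qpoch x n"
proof -
  have "x ^ i < 1" if "i \<in> {1..n}" for i
    using that assms power_Suc_less_one[of x "i - 1"] by simp
  then show ?thesis unfolding qpoch_def by (intro prod_pos) simp
qed

lemma qpoch_Suc_le:
  assumes "0 < x" "x < 1"
  shows "qpoch x (Suc n) \<le> qpoch x n"
  unfolding qpoch_Suc using qpoch_pos[OF assms, of n] assms by (intro mult_left_le) auto

lemma qpoch_antimono:
  assumes "0 < x" "x < 1" "m \<le> n"
  shows "qpoch x n \<le> qpoch x m"
  using lift_Suc_antimono_le[of "qpoch x" m n] qpoch_Suc_le assms by auto

lemma convergent_prod_qpoch:
  assumes "0 < x" "x < 1"
  shows "convergent_prod (\<lambda>i. 1 - x ^ Suc i :: real)"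
proof -
  have "summable (\<lambda>i. x ^ Suc i)"
    using assms by (subst summable_Suc_iff) (intro summable_geometric; simp)
  then have "abs_convergent_prod (\<lambda>i. 1 + (- (x ^ Suc i)))"
    using assms by (intro summable_imp_abs_convergent_prod) simp
  then show ?thesis using abs_convergent_prod_imp_convergent_prod by fastforce
qed

lemma qpoch_LIMSEQ:
  assumes "0 < x" "x < 1"
  shows "qpoch x \<longlonglongrightarrow> (\<Prod>i. 1 - x ^ Suc i)"
proof -
  have "qpoch x (Suc n) = (\<Prod>i\<le>n. 1 - x ^ Suc i)" for n
    by (simp only: qpoch_def One_nat_def prod.atLeast1_atMost_eq lessThan_Suc_atMost)
  then have "(\<lambda>n. qpoch x (Suc n)) \<longlonglongrightarrow> (\<Prod>i. 1 - x ^ Suc i)"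
    using convergent_prod_LIMSEQ[OF convergent_prod_qpoch[OF assms]] by simp
  then show ?thesis by (rule LIMSEQ_imp_Suc)
qed

text \<open>
  The factors between \<open>m\<close> and \<open>m + d\<close> cost at most the sum of the \<open>x ^ i\<close> with \<open>i > m\<close>, which is at
  most \<open>x ^ m\<close> when \<open>x \<le> 1 / 2\<close>.
\<close>
lemma qpoch_add_ge:
  assumes "0 < x" "x \<le> 1 / 2"
  shows "qpoch x m * (1 - x ^ m) \<le> qpoch x (m + d)"
proof -
  \<comment> \<open>The extra term \<open>x ^ (m + d)\<close> dominates the part of the geometric tail still to come, which makes the
    induction go through.\<close>
  have "qpoch x m * (1 - x ^ m + x ^ (m + d)) \<le> qpoch x (m + d)"
  proof (induction d)
    case (Suc d)
    define A B where "A = x ^ m" and "B = x ^ (m + d)"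
    have B: "0 < B" "B \<le> A" using assms by (auto simp: A_def B_def intro!: power_decreasing)
    have xB: "0 < x * B" "2 * (x * B) \<le> B"
      using assms B mult_right_mono[of x "1/2" B] by auto
    have "x * B * (1 - A + B) \<le> x * B * 1" using B xB by (intro mult_left_mono) auto
    moreover have "(1 - A + B) * (1 - x * B) = 1 - A + B - x * B * (1 - A + B)"
      by (simp add: algebra_simps)
    ultimately have "1 - A + x * B \<le> (1 - A + B) * (1 - x * B)"
      using xB by linarith
    then have "qpoch x m * (1 - A + x * B) \<le> qpoch x m * ((1 - A + B) * (1 - x * B))"
      using qpoch_pos[of x m] assms by (intro mult_left_mono) auto
    also have "\<dots> \<le> qpoch x (m + d) * (1 - x * B)"
    proof -
      have "x * B \<le> 1" using power_le_one[of x "Suc (m + d)"] assms by (simp add: B_def)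
      then show ?thesis
        using Suc.IH unfolding A_def B_def mult.assoc[symmetric] by (intro mult_right_mono) auto
    qed
    finally show ?case by (simp add: qpoch_Suc A_def B_def)
  qed simp
  moreover have "qpoch x m * (1 - x ^ m) \<le> qpoch x m * (1 - x ^ m + x ^ (m + d))"
    using qpoch_pos[of x m] assms by (intro mult_left_mono) auto
  ultimately show ?thesis by linarith
qed

lemma qpoch_limit_ge:
  assumes "0 < x" "x \<le> 1 / 2"
  shows "qpoch x m * (1 - x ^ m) \<le> (\<Prod>i. 1 - x ^ Suc i)"
proof -
  have "(\<lambda>d. qpoch x (d + m)) \<longlonglongrightarrow> (\<Prod>i. 1 - x ^ Suc i)"
    using qpoch_LIMSEQ[of x] assms by (intro LIMSEQ_ignore_initial_segment) auto
  then show ?thesis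
    using qpoch_add_ge[OF assms, of m] by (intro LIMSEQ_le_const) (auto simp: add.commute)
qed

text \<open>Extending the tail product of the definition to a full one costs a second factor \<open>qpoch x k\<close>.\<close>
lemma Q_infty_mass_eq:
  assumes "q \<ge> 2"
  shows "Q_infty_mass q k =
    (1 / real q) ^ k\<^sup>2 * (\<Prod>i. 1 - (1 / real q) ^ Suc i) / (qpoch (1 / real q) k)\<^sup>2"
proof -
  define x where "x = 1 / real q"
  have x: "0 < x" "x < 1" using assms by (auto simp: x_def)
  have "1 - x ^ Suc i \<noteq> 0" for i using power_Suc_less_one[of x i] x by simp
  then have "(\<Prod>i. 1 - x ^ Suc i) = (\<Prod>i. 1 - x ^ Suc (i + k)) * (\<Prod>i<k. 1 - x ^ Suc i)"
    by (intro prodinf_split_initial_segment convergent_prod_qpoch x) auto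
  also have "(\<Prod>i<k. 1 - x ^ Suc i) = qpoch x k"
    by (simp only: qpoch_def One_nat_def prod.atLeast1_atMost_eq)
  also have "(\<lambda>i. 1 - x ^ Suc (i + k)) = (\<lambda>i. 1 - x ^ (k + 1 + i))"
    by (simp add: add.commute)
  finally have "(\<Prod>i. 1 - x ^ (k + 1 + i)) = (\<Prod>i. 1 - x ^ Suc i) / qpoch x k"
    using qpoch_pos[OF x, of k] by (simp add: eq_divide_eq)
  moreover have "Q_infty_mass q k = x ^ k\<^sup>2 * ((\<Prod>i. 1 - x ^ (k + 1 + i)) / qpoch x k)"
    unfolding Q_infty_mass_def qpoch_def x_def power_one_over ..
  ultimately show ?thesis by (simp add: x_def power2_eq_square)
qed

section \<open>Gaussian binomial coefficients\<close>

text \<open>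
  Pascal's rule serves as the definition, since counting extensions of a list of vectors produces
  exactly this recurrence.
\<close>
fun gauss_binomial :: "nat \<Rightarrow> nat \<Rightarrow> nat \<Rightarrow> nat" where
  "gauss_binomial q b 0 = 1"
| "gauss_binomial q 0 (Suc j) = 0"
| "gauss_binomial q (Suc b) (Suc j) = q ^ Suc j * gauss_binomial q b (Suc j) + gauss_binomial q b j"

lemma gauss_binomial_eq_0: "b < j \<Longrightarrow> gauss_binomial q b j = 0"
  by (induction q b j rule: gauss_binomial.induct) auto

lemma gauss_binomial_eq_qpoch:
  assumes "q \<ge> 2"
  defines "x \<equiv> 1 / real q"
  shows "real (gauss_binomial q (j + l) j) = real q ^ (j * l) * qpoch x (j + l) / (qpoch x j * qpoch x l)"
proof -
  have x: "0 < x" "x < 1" using assms by (auto simp: x_def)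
  have ne: "qpoch x i \<noteq> 0" "1 - x ^ Suc i \<noteq> 0" for i
    using qpoch_pos[OF x, of i] power_Suc_less_one[of x i] x by auto
  show ?thesis
  proof (induction "j + l" arbitrary: j l)
    case 0 then show ?case by simp
  next
    case (Suc s)
    show ?case
    proof (cases j)
      case 0 then show ?thesis using ne by simp
    next
      case j: (Suc j')
      show ?thesis
      proof (cases l)
        case 0
        have "real (gauss_binomial q (j' + 0) j') = 1"
          using Suc.hyps(1)[of j' 0] Suc.hyps(2) j 0 ne by simp
        then show ?thesis using 0 j ne by (simp add: gauss_binomial_eq_0)
      next
        case l: (Suc l')
        define Y where "Y = qpoch x (j' + l)"
        have e1: "real (gauss_binomial q (j + l') j) = real q ^ (j * l') * Y / (qpoch x j * qpoch x l')"
          using Suc.hyps(1)[of j l'] Suc.hyps(2) j l by (simp add: Y_def)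
        have e2: "real (gauss_binomial q (j' + l) j') = real q ^ (j' * l) * Y / (qpoch x j' * qpoch x l)"
          using Suc.hyps(1)[of j' l] Suc.hyps(2) j l by (simp add: Y_def)
        have pj: "qpoch x j = qpoch x j' * (1 - x ^ j)" and pl: "qpoch x l = qpoch x l' * (1 - x ^ l)"
          using j l by (simp_all add: qpoch_Suc)
        have nj: "1 - x ^ j \<noteq> 0" "1 - x ^ l \<noteq> 0" using ne(2)[of j'] ne(2)[of l'] j l by auto
        have qe1: "real q ^ j * real q ^ (j * l') = real q ^ (j * l)"
          by (simp add: l flip: power_add)
        have qe2: "real q ^ (j' * l) = real q ^ (j * l) * x ^ l"
          using assms by (simp add: j x_def power_add power_one_over)
        have "gauss_binomial q (j + l) j = q ^ j * gauss_binomial q (j + l') j + gauss_binomial q (j' + l) j'"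
          by (simp add: j l)
        then have "real (gauss_binomial q (j + l) j) =
            real q ^ j * (real q ^ (j * l') * Y / (qpoch x j * qpoch x l'))
            + real q ^ (j' * l) * Y / (qpoch x j' * qpoch x l)"
          by (simp add: e1 e2)
        also have "\<dots> = real q ^ (j * l) * Y / (qpoch x j * qpoch x l')
            + real q ^ (j * l) * x ^ l * Y / (qpoch x j' * qpoch x l)"
          by (simp only: qe1[symmetric] qe2) simp
        also have "\<dots> = real q ^ (j * l) * (Y * (1 - x ^ j * x ^ l)) / (qpoch x j * qpoch x l)"
          unfolding pj pl using ne(1)[of j'] ne(1)[of l'] nj
          by (simp add: divide_simps) (simp add: algebra_simps)
        also have "Y * (1 - x ^ j * x ^ l) = qpoch x (j + l)"
          by (simp add: Y_def j l qpoch_Suc power_add)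
        finally show ?thesis .
      qed
    qed
  qed
qed

text \<open>
  The number of linearly independent lists of \<open>j\<close> vectors in a space of dimension \<open>k\<close> over a field
  with \<open>q\<close> elements. For \<open>j > k\<close> it is \<open>0\<close>, because the factor with \<open>i = k\<close> vanishes.
\<close>
definition num_frames :: "nat \<Rightarrow> nat \<Rightarrow> nat \<Rightarrow> nat" where
  "num_frames q k j = (\<Prod>i<j. q ^ k - q ^ i)"

text \<open>
  Modulo the span of the first \<open>m - k\<close> vectors of a basis, the other \<open>k\<close> form a basis of a space of
  dimension \<open>k\<close>, and each of them has \<open>q ^ (m - k)\<close> lifts.
\<close>
lemma num_frames_split:
  assumes "k \<le> m"
  shows "num_frames q m m = num_frames q m (m - k) * (q ^ ((m - k) * k) * num_frames q k k)"
proof -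
  have "num_frames q m m = num_frames q m (m - k) * (\<Prod>i = m - k..<m. q ^ m - q ^ i)"
    unfolding num_frames_def by (simp add: prod.atLeastLessThan_concat lessThan_atLeast0)
  also have "(\<Prod>i = m - k..<m. q ^ m - q ^ i) = (\<Prod>i = 0..<k. q ^ m - q ^ (i + (m - k)))"
    using prod.shift_bounds_nat_ivl[of "\<lambda>i. q ^ m - q ^ i" 0 "m - k" k] assms by simp
  also have "\<dots> = (\<Prod>i<k. q ^ (m - k) * (q ^ k - q ^ i))"
    using assms by (intro prod.cong) (auto simp: diff_mult_distrib2 simp flip: power_add intro!: arg_cong2[of _ _ _ _ "(-)"] arg_cong[of _ _ "(^) q"])
  also have "\<dots> = q ^ ((m - k) * k) * num_frames q k k"
    by (simp add: prod.distrib num_frames_def power_mult)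
  finally show ?thesis .
qed

lemma num_frames_pos:
  assumes "q \<ge> 2" "j \<le> k"
  shows "0 < num_frames q k j"
  unfolding num_frames_def using assms by (intro prod_pos) (auto intro!: power_strict_increasing)

section \<open>Rank and the number of vectors in a span\<close>

lemma card_field_ge_2: "CARD('a::{finite,field}) \<ge> 2"
  using card_mono[of "UNIV :: 'a set" "{0, 1}"] by simp

lemma card_carrier_vec: "card (carrier_vec n :: 'a::{finite,field} vec set) = CARD('a) ^ n"
  and finite_carrier_vec: "finite (carrier_vec n :: 'a vec set)"
proof -
  have bij: "bij_betw list_of_vec (carrier_vec n :: 'a vec set) {xs. set xs \<subseteq> UNIV \<and> length xs = n}"
  proof (rule bij_betwI[where g = vec_of_list])
    show "list_of_vec \<in> (carrier_vec n :: 'a vec set) \<rightarrow> {xs. set xs \<subseteq> UNIV \<and> length xs = n}"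
      using carrier_vecD by (intro Pi_I) (simp add: Matrix.length_list_of_vec)
    show "vec_of_list \<in> {xs. set xs \<subseteq> UNIV \<and> length xs = n} \<rightarrow> (carrier_vec n :: 'a vec set)"
      by (intro Pi_I carrier_vecI) simp
  qed (simp_all add: vec_list list_vec)
  show "card (carrier_vec n :: 'a vec set) = CARD('a) ^ n"
    using bij_betw_same_card[OF bij] card_lists_length_eq[of "UNIV :: 'a set" n] by simp
  show "finite (carrier_vec n :: 'a vec set)"
    using bij_betw_finite[OF bij] finite_lists_length_eq[of "UNIV :: 'a set" n] by simp
qed

locale finite_vec_space = vec_space f_ty n
  for f_ty :: "'a :: {finite,field} itself" and n :: nat
begin

lemma span_insert_eq:
  assumes "S \<subseteq> carrier_vec n" "v \<in> carrier_vec n" "finite S"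
  shows "span (insert v S) = (\<lambda>(c, u). c \<cdot>\<^sub>v v + u) ` (UNIV \<times> span S)"
proof -
  from assms obtain vs where vs: "S = set vs" using finite_list by blast
  have "span (insert v S) = span_list (v # vs)"
    using assms vs by (subst span_list_as_span) auto
  also have "\<dots> = (\<lambda>(c, u). c \<cdot>\<^sub>v v + u) ` (UNIV \<times> span_list vs)"
  proof (intro equalityI subsetI)
    fix x assume "x \<in> span_list (v # vs)"
    then obtain c where "x = lincomb_list c (v # vs)" by (auto elim!: in_span_listE)
    then show "x \<in> (\<lambda>(c, u). c \<cdot>\<^sub>v v + u) ` (UNIV \<times> span_list vs)"
      by (auto intro!: image_eqI[of _ _ "(c 0, lincomb_list (c \<circ> Suc) vs)"] in_span_listI)
  next
    fix x assume "x \<in> (\<lambda>(c, u). c \<cdot>\<^sub>v v + u) ` (UNIV \<times> span_list vs)"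
    then obtain a c where "x = a \<cdot>\<^sub>v v + lincomb_list c vs" by (auto elim!: in_span_listE)
    then have "x = lincomb_list (case_nat a c) (v # vs)"
      by (simp add: comp_def)
    then show "x \<in> span_list (v # vs)" by (intro in_span_listI[where c = "case_nat a c"]) auto
  qed
  finally show ?thesis using assms vs by (simp add: span_list_as_span)
qed

lemma finite_span_finite: "S \<subseteq> carrier_vec n \<Longrightarrow> finite (span S)"
  using finite_subset[OF span_is_subset2 finite_carrier_vec] by blast

lemma card_span_insert:
  assumes S: "S \<subseteq> carrier_vec n" and v: "v \<in> carrier_vec n" and fin: "finite S" and nv: "v \<notin> span S"
  shows "card (span (insert v S)) = CARD('a) * card (span S)"
proof -
  \<comment> \<open>Two representations with different coefficients of \<open>v\<close> could be solved for \<open>v\<close>.\<close>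
  have "inj_on (\<lambda>(c, u). c \<cdot>\<^sub>v v + u) (UNIV \<times> span S)"
  proof (rule inj_onI, clarify)
    fix a b x y
    assume x: "x \<in> span S" and y: "y \<in> span S" and eq: "a \<cdot>\<^sub>v v + x = b \<cdot>\<^sub>v v + y"
    have c: "x \<in> carrier_vec n" "y \<in> carrier_vec n" using x y S by (auto dest: span_closed[OF S])
    have "a = b"
    proof (rule ccontr)
      assume ab: "a \<noteq> b"
      have "(a - b) \<cdot>\<^sub>v v = y + (- 1) \<cdot>\<^sub>v x"
      proof (rule eq_vecI)
        fix i assume i: "i < dim_vec (y + (- 1) \<cdot>\<^sub>v x)"
        have "(a \<cdot>\<^sub>v v + x) $ i = (b \<cdot>\<^sub>v v + y) $ i" using eq by simp
        then show "((a - b) \<cdot>\<^sub>v v) $ i = (y + (- 1) \<cdot>\<^sub>v x) $ i"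
          using i v c by (simp add: algebra_simps)
      qed (use v c in auto)
      moreover have "y + (- 1) \<cdot>\<^sub>v x \<in> span S"
        using span_add1[OF _ y smult_in_span[OF S x]] S by simp
      ultimately have "inverse (a - b) \<cdot>\<^sub>v ((a - b) \<cdot>\<^sub>v v) \<in> span S"
        using smult_in_span[OF S] by simp
      then show False using ab nv v by (simp add: smult_smult_assoc)
    qed
    moreover have "x = y"
    proof (rule eq_vecI)
      fix i assume i: "i < dim_vec y"
      have "(a \<cdot>\<^sub>v v + x) $ i = (b \<cdot>\<^sub>v v + y) $ i" using eq by simp
      then show "x $ i = y $ i" using i v c \<open>a = b\<close> by simp
    qed (use c in auto)
    ultimately show "a = b \<and> x = y" by simp
  qed
  then show ?thesis
    unfolding span_insert_eq[OF S v fin] by (simp add: card_image card_cartesian_product)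
qed

text \<open>
  Ranks of lists of vectors, so that the columns of a matrix can be added one at a time and the rows of
  another matrix be treated in the same way.
\<close>
definition list_rank :: "'a vec list \<Rightarrow> nat" where
  "list_rank ws = vectorspace.dim class_ring (span_vs (set ws))"

lemma rank_eq_list_rank: "rank A = list_rank (cols A)"
  by (simp add: rank_def list_rank_def)

lemma card_span_lin_indpt:
  assumes "finite U" "U \<subseteq> carrier_vec n" "lin_indpt U"
  shows "card (span U) = CARD('a) ^ card U"
  using assms
proof (induction U rule: finite_induct)
  case empty then show ?case by (simp add: span_empty)
next
  case (insert x F)
  have ind: "lin_indpt F" using insert.prems(2) subset_li_is_li by blast
  have "x \<notin> span F"
    using lin_dep_iff_in_span[of F x] ind insert by auto
  then show ?case using insert ind by (simp add: card_span_insert)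
qed

text \<open>
  The span has a basis \<open>U\<close> inside \<open>ws\<close>, and each vector of a basis multiplies the number of vectors
  by that of the scalars. Ranks can therefore be compared by counting vectors.
\<close>
lemma card_span_eq_power_rank:
  assumes ws: "set ws \<subseteq> carrier_vec n"
  shows "card (span (set ws)) = CARD('a) ^ list_rank ws"
proof -
  have "lin_indpt {}" by (auto simp: lin_dep_def)
  then obtain U where U: "finite U" "maximal U (\<lambda>T. T \<subseteq> set ws \<and> lin_indpt T)"
    using maximal_exists_superset[of "set ws" "\<lambda>T. T \<subseteq> set ws \<and> lin_indpt T" "{}"] by auto
  then have sub: "U \<subseteq> set ws" and ind: "lin_indpt U" by (auto simp: maximal_def)
  have Uc: "U \<subseteq> carrier_vec n" using sub ws by simp
  have "set ws \<subseteq> span U"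
  proof
    fix v assume v: "v \<in> set ws"
    show "v \<in> span U"
    proof (rule ccontr)
      assume nv: "v \<notin> span U"
      then have nU: "v \<notin> U" using Uc span_mem by auto
      then have "lin_indpt (insert v U)"
        using lin_dep_iff_in_span[of U v] Uc ind nv v ws by auto
      then have "insert v U = U"
        using U(2) v sub unfolding maximal_def by blast
      then show False using nU by blast
    qed
  qed
  then have "span (set ws) = span U"
    using span_subsetI[OF Uc] span_is_monotone[OF sub] by blast
  then show ?thesis
    using card_span_lin_indpt[OF U(1) Uc ind] dim_span[of "set ws" U] U ws
    by (simp add: list_rank_def)
qed

lemma list_rank_cong: "span (set us) = span (set vs') \<Longrightarrow> list_rank us = list_rank vs'"
  by (simp add: list_rank_def)

lemma list_rank_Cons_in:
  assumes "set ws \<subseteq> carrier_vec n" "u \<in> span (set ws)"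
  shows "list_rank (u # ws) = list_rank ws"
proof -
  have "span (insert u (set ws)) \<subseteq> span (set ws)"
    using assms by (intro span_subsetI) (auto simp: in_own_span)
  moreover have "span (set ws) \<subseteq> span (insert u (set ws))"
    by (intro span_is_monotone) auto
  ultimately show ?thesis by (intro list_rank_cong) auto
qed

lemma list_rank_Cons_notin:
  assumes "set ws \<subseteq> carrier_vec n" "u \<in> carrier_vec n" "u \<notin> span (set ws)"
  shows "list_rank (u # ws) = Suc (list_rank ws)"
proof -
  have "CARD('a) ^ list_rank (u # ws) = CARD('a) ^ Suc (list_rank ws)"
    using card_span_insert[of "set ws" u] card_span_eq_power_rank[of "u # ws"]
      card_span_eq_power_rank[of ws] assms by simp
  then show ?thesis
    using card_field_ge_2[where 'a = 'a] by (subst (asm) power_inject_exp) auto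
qed

lemma list_rank_append_ge:
  assumes "set ws \<subseteq> carrier_vec n" "set us \<subseteq> carrier_vec n"
  shows "list_rank ws \<le> list_rank (us @ ws)"
  using assms(2)
proof (induction us)
  case (Cons u us)
  then show ?case
    using list_rank_Cons_in[of "us @ ws" u] list_rank_Cons_notin[of "us @ ws" u] assms(1)
    by (cases "u \<in> span (set (us @ ws))") auto
qed simp

lemma list_rank_Nil: "list_rank [] = 0"
proof -
  have "CARD('a) ^ list_rank [] = CARD('a) ^ 0"
    using card_span_eq_power_rank[of "[]"] by (simp add: span_empty)
  then show ?thesis
    using card_field_ge_2[where 'a = 'a] by (subst (asm) power_inject_exp) auto
qed

lemma list_rank_le:
  assumes "set ws \<subseteq> carrier_vec n"
  shows "list_rank ws \<le> n"
proof -
  have "CARD('a) ^ list_rank ws \<le> CARD('a) ^ n"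
    using card_mono[OF finite_carrier_vec span_is_subset2[OF assms]]
    by (simp add: card_span_eq_power_rank[OF assms] card_carrier_vec)
  then show ?thesis
    using card_field_ge_2[where 'a = 'a] by (subst (asm) power_increasing_iff) auto
qed

lemma list_rank_full_iff:
  assumes "set ws \<subseteq> carrier_vec n"
  shows "list_rank ws = n \<longleftrightarrow> span (set ws) = carrier_vec n"
proof
  assume "list_rank ws = n"
  then show "span (set ws) = carrier_vec n"
    using card_subset_eq[OF finite_carrier_vec span_is_subset2[OF assms]]
    by (simp add: card_span_eq_power_rank[OF assms] card_carrier_vec)
next
  assume "span (set ws) = carrier_vec n"
  then have "CARD('a) ^ list_rank ws = CARD('a) ^ n"
    using card_span_eq_power_rank[OF assms] card_carrier_vec[of n, where 'a = 'a] by simp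
  then show "list_rank ws = n"
    using card_field_ge_2[where 'a = 'a] by (subst (asm) power_inject_exp) auto
qed

section \<open>Counting extensions of a list of vectors\<close>

definition extensions :: "nat \<Rightarrow> 'a vec list \<Rightarrow> nat \<Rightarrow> 'a vec list set" where
  "extensions b ws s =
     {us. length us = b \<and> set us \<subseteq> carrier_vec n \<and> list_rank (us @ ws) = s}"

lemma finite_extensions: "finite (extensions b ws s)"
  by (rule finite_subset[OF _ finite_lists_length_eq[OF finite_carrier_vec, of n b]])
    (auto simp: extensions_def)

text \<open>
  The vector added last either lies in the span of the others, which already has rank \<open>s\<close>, or it lies
  outside of it and raises the rank from \<open>s - 1\<close> to \<open>s\<close>.
\<close>
lemma card_extensions_Suc:
  assumes ws: "set ws \<subseteq> carrier_vec n"
  shows "card (extensions (Suc b) ws s) =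
    CARD('a) ^ s * card (extensions b ws s) +
    (if s = 0 then 0 else (CARD('a) ^ n - CARD('a) ^ (s - 1)) * card (extensions b ws (s - 1)))"
proof -
  let ?span = "\<lambda>us. span (set (us @ ws))"
  let ?A = "SIGMA us:extensions b ws s. ?span us"
  let ?E = "if s = 0 then {} else extensions b ws (s - 1)"
  let ?B = "SIGMA us:?E. carrier_vec n - ?span us"
  have sub: "set (us @ ws) \<subseteq> carrier_vec n" if "us \<in> extensions b ws t" for us t
    using that ws by (auto simp: extensions_def)
  have card_span: "card (?span us) = CARD('a) ^ t" if "us \<in> extensions b ws t" for us t
    using card_span_eq_power_rank[OF sub[OF that]] that by (simp add: extensions_def)
  have fin: "finite (?span us)" if "us \<in> extensions b ws t" for us t
    using finite_span_finite[OF sub[OF that]] .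
  have "bij_betw (\<lambda>(us, u). u # us) (?A \<union> ?B) (extensions (Suc b) ws s)"
  proof (rule bij_betwI[where g = "\<lambda>us. (tl us, hd us)"])
    show "(\<lambda>(us, u). u # us) \<in> ?A \<union> ?B \<rightarrow> extensions (Suc b) ws s"
    proof (rule Pi_I)
      fix p assume p: "p \<in> ?A \<union> ?B"
      obtain us u where pe: "p = (us, u)" by (cases p)
      have us: "length us = b" "set us \<subseteq> carrier_vec n" "set (us @ ws) \<subseteq> carrier_vec n"
        using p pe ws by (auto simp: extensions_def split: if_splits)
      have u: "u \<in> carrier_vec n" using p pe us span_closed[OF us(3)] by auto
      have "list_rank (u # us @ ws) = s"
        using p pe us u list_rank_Cons_in[OF us(3), of u] list_rank_Cons_notin[OF us(3), of u]
        by (auto simp: extensions_def split: if_splits)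
      then show "(\<lambda>(us, u). u # us) p \<in> extensions (Suc b) ws s"
        using us u by (simp add: pe extensions_def)
    qed
    show "(\<lambda>us. (tl us, hd us)) \<in> extensions (Suc b) ws s \<rightarrow> ?A \<union> ?B"
    proof (rule Pi_I)
      fix vs' assume v: "vs' \<in> extensions (Suc b) ws s"
      then obtain u us where vu: "vs' = u # us" by (cases vs') (auto simp: extensions_def)
      have us: "set (us @ ws) \<subseteq> carrier_vec n" "u \<in> carrier_vec n" "length us = b"
        "list_rank (u # us @ ws) = s"
        using v vu ws by (auto simp: extensions_def)
      show "(tl vs', hd vs') \<in> ?A \<union> ?B"
        using us list_rank_Cons_in[OF us(1), of u] list_rank_Cons_notin[OF us(1), of u]
        by (cases "u \<in> ?span us") (auto simp: vu extensions_def)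
    qed
  qed (auto simp: extensions_def length_Suc_conv)
  then have "card (extensions (Suc b) ws s) = card (?A \<union> ?B)"
    by (rule bij_betw_same_card[symmetric])
  also have "\<dots> = card ?A + card ?B"
  proof (rule card_Un_disjoint)
    show "finite ?A" using fin by (intro finite_SigmaI finite_extensions) auto
    show "finite ?B" by (intro finite_SigmaI) (auto simp: finite_extensions finite_carrier_vec)
    show "?A \<inter> ?B = {}" by (auto simp: extensions_def)
  qed
  also have "card ?A = CARD('a) ^ s * card (extensions b ws s)"
    using fin card_span by (subst card_SigmaI) (auto simp: finite_extensions)
  also have "card ?B = (if s = 0 then 0
      else (CARD('a) ^ n - CARD('a) ^ (s - 1)) * card (extensions b ws (s - 1)))"
  proof (cases "s = 0")
    case False
    have "card (carrier_vec n - ?span us) = CARD('a) ^ n - CARD('a) ^ (s - 1)"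
      if "us \<in> extensions b ws (s - 1)" for us
      using that fin[OF that] card_span[OF that] span_is_subset2[OF sub[OF that]]
      by (subst card_Diff_subset) (auto simp: card_carrier_vec)
    then show ?thesis
      using False by (subst card_SigmaI) (auto simp: finite_extensions finite_carrier_vec)
  qed simp
  finally show ?thesis .
qed

text \<open>
  Modulo the span of \<open>ws\<close> this counts lists of \<open>b\<close> vectors of rank \<open>j\<close> in a space of dimension
  \<open>n - r\<close>, each vector having \<open>q ^ r\<close> lifts. Such a list is a matrix of rank \<open>j\<close>: the Gaussian
  binomial coefficient counts its row spaces, and the frames count the matrices with a given row space.
\<close>
lemma card_extensions:
  assumes ws: "set ws \<subseteq> carrier_vec n"
  defines "r \<equiv> list_rank ws"
  shows "card (extensions b ws (r + j)) =
    CARD('a) ^ (r * b) * gauss_binomial CARD('a) b j * num_frames CARD('a) (n - r) j"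
proof (induction b arbitrary: j)
  case 0
  have "extensions 0 ws (r + j) = (if j = 0 then {[]} else {})"
    by (auto simp: extensions_def r_def)
  then show ?case by (cases j) (simp_all add: num_frames_def)
next
  case (Suc b)
  show ?case
  proof (cases j)
    case 0
    have "extensions b ws (r - 1) = {}" if "r \<noteq> 0"
      using list_rank_append_ge[OF ws] that by (fastforce simp: extensions_def r_def)
    then show ?thesis
      using Suc.IH[of 0] 0 card_extensions_Suc[OF ws, of b r]
      by (simp add: num_frames_def power_add)
  next
    case (Suc i)
    have rn: "r \<le> n" using list_rank_le[OF ws] by (simp add: r_def)
    have diff: "CARD('a) ^ n - CARD('a) ^ (r + i) = CARD('a) ^ r * (CARD('a) ^ (n - r) - CARD('a) ^ i)"
      using rn by (simp add: diff_mult_distrib2 flip: power_add)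
    define c F where "c = CARD('a) ^ (n - r) - CARD('a) ^ i"
      and "F = num_frames CARD('a) (n - r) i"
    have frames: "num_frames CARD('a) (n - r) j = F * c"
      by (simp add: num_frames_def Suc F_def c_def)
    have "card (extensions (Suc b) ws (r + j)) =
        CARD('a) ^ r * CARD('a) ^ j * card (extensions b ws (r + j)) +
        CARD('a) ^ r * c * card (extensions b ws (r + i))"
      using card_extensions_Suc[OF ws, of b "r + j"] Suc diff by (simp add: power_add c_def)
    also have "\<dots> = CARD('a) ^ r * CARD('a) ^ (r * b) * (F * c) *
        (CARD('a) ^ j * gauss_binomial CARD('a) b j + gauss_binomial CARD('a) b i)"
      unfolding Suc.IH frames F_def[symmetric] by (simp add: algebra_simps)
    finally show ?thesis
      unfolding frames by (simp add: Suc power_add)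
  qed
qed

end

section \<open>Full-rank rectangles inside invertible matrices\<close>

context finite_vec_space
begin

lemma rank_full_iff_surj:
  assumes "A \<in> carrier_mat n nc"
  shows "rank A = n \<longleftrightarrow> (\<forall>y\<in>carrier_vec n. \<exists>x\<in>carrier_vec nc. A *\<^sub>v x = y)"
proof -
  have "set (cols A) \<subseteq> carrier_vec n" using assms cols_dim by blast
  then have "rank A = n \<longleftrightarrow> col_space A = carrier_vec n"
    by (simp add: rank_eq_list_rank list_rank_full_iff col_space_def)
  then show ?thesis using assms unfolding col_space_eq[OF assms] by auto
qed

lemma card_col_space: "A \<in> carrier_mat n nc \<Longrightarrow> card (col_space A) = CARD('a) ^ rank A"
  unfolding col_space_def rank_eq_list_rank
  by (intro card_span_eq_power_rank) (use cols_dim in blast)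

end

text \<open>
  If \<open>T\<close> is onto, then its transpose is injective, since a vector orthogonal to the image of \<open>T\<close> is
  \<open>0\<close>. So the image of the transpose has as many vectors as its domain, and its rank is \<open>m\<close>.
\<close>
lemma rank_transpose_of_full_row_rank:
  fixes T :: "'a::{finite,field} mat"
  assumes T: "T \<in> carrier_mat m n" and full: "vec_space.rank m T = m"
  shows "vec_space.rank n T\<^sup>T = m"
proof -
  interpret M: finite_vec_space "TYPE('a)" m .
  interpret N: finite_vec_space "TYPE('a)" n .
  have surj: "\<exists>x\<in>carrier_vec n. T *\<^sub>v x = y" if "y \<in> carrier_vec m" for y
    using M.rank_full_iff_surj[OF T] full that by blast
  have T': "T\<^sup>T \<in> carrier_mat n m" using T by simp
  have "inj_on (\<lambda>y. T\<^sup>T *\<^sub>v y) (carrier_vec m)"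
  proof (rule inj_onI)
    fix y z :: "'a vec" assume y: "y \<in> carrier_vec m" and z: "z \<in> carrier_vec m"
      and eq: "T\<^sup>T *\<^sub>v y = T\<^sup>T *\<^sub>v z"
    show "y = z"
    proof (rule eq_vecI)
      fix i assume "i < dim_vec z"
      then have i: "i < m" using z by simp
      obtain x where x: "x \<in> carrier_vec n" "T *\<^sub>v x = unit_vec m i"
        using surj[of "unit_vec m i"] by auto
      have "y \<bullet> (T *\<^sub>v x) = z \<bullet> (T *\<^sub>v x)"
        using transpose_vec_mult_scalar[OF T x(1) y] transpose_vec_mult_scalar[OF T x(1) z] eq
        by simp
      then show "y $ i = z $ i" using i y z by (simp add: x(2))
    qed (use y z in simp)
  qed
  moreover have "N.col_space T\<^sup>T = (\<lambda>y. T\<^sup>T *\<^sub>v y) ` carrier_vec m"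
    unfolding N.col_space_eq[OF T'] using T by (auto intro!: mult_mat_vec_carrier[OF T'])
  ultimately have "CARD('a) ^ N.rank T\<^sup>T = CARD('a) ^ m"
    using N.card_col_space[OF T'] card_carrier_vec[of m, where 'a = 'a] by (simp add: card_image)
  then show ?thesis
    using card_field_ge_2[where 'a = 'a] by (subst (asm) power_inject_exp) auto
qed

lemma invertible_mat_iff_det:
  fixes A :: "'a::field mat"
  assumes A: "A \<in> carrier_mat n n"
  shows "invertible_mat A \<longleftrightarrow> det A \<noteq> 0"
proof
  assume "invertible_mat A"
  then obtain B where B: "A * B = 1\<^sub>m n" "B * A = 1\<^sub>m (dim_row B)"
    using A by (auto simp: invertible_mat_def inverts_mat_def)
  have "dim_col (A * B) = n" "dim_col (B * A) = dim_row B" by (simp_all add: B)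
  then have "B \<in> carrier_mat n n" using A by auto
  then have "det A * det B = 1" using det_mult[OF A] B(1) det_one by metis
  then show "det A \<noteq> 0" by auto
next
  assume "det A \<noteq> 0"
  from det_non_zero_imp_unit[OF A this, of "()"]
  obtain B where "B \<in> carrier_mat n n" "B * A = 1\<^sub>m n" "A * B = 1\<^sub>m n"
    unfolding Units_def ring_mat_def by auto
  then show "invertible_mat A"
    using A by (auto simp: invertible_mat_def inverts_mat_def square_mat.simps)
qed

lemma GL_iff_list_rank_rows:
  fixes A :: "'a::{finite,field} mat"
  assumes A: "A \<in> carrier_mat n n"
  shows "A \<in> GL n \<longleftrightarrow> finite_vec_space.list_rank n (rows A) = n"
proof -
  interpret N: finite_vec_space "TYPE('a)" n .
  have "A \<in> GL n \<longleftrightarrow> det A \<noteq> 0"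
    using A by (simp add: GL_def invertible_mat_iff_det)
  also have "\<dots> \<longleftrightarrow> det A\<^sup>T \<noteq> 0" by (simp add: det_transpose[OF A])
  also have "\<dots> \<longleftrightarrow> N.rank A\<^sup>T = n" using A by (intro N.det_rank_iff) simp
  finally show ?thesis by (simp add: N.rank_eq_list_rank)
qed

text \<open>
  An invertible matrix is onto, hence so are its upper \<open>m\<close> rows: a preimage of \<open>y\<close> under them is found
  by inverting the matrix on \<open>y\<close> padded with zeros.
\<close>
lemma full_row_rank_of_GL:
  fixes T :: "'a::{finite,field} mat"
  assumes T: "T \<in> carrier_mat m n"
    and len: "length us = n - m" "m \<le> n" and us: "set us \<subseteq> carrier_vec n"
    and GL: "mat_of_rows n (rows T @ us) \<in> GL n"
  shows "vec_space.rank m T = m"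
proof -
  interpret M: finite_vec_space "TYPE('a)" m .
  let ?A = "mat_of_rows n (rows T @ us)"
  have A: "?A \<in> carrier_mat n n" and "invertible_mat ?A" using GL by (auto simp: GL_def)
  then obtain B where B: "?A * B = 1\<^sub>m n" "B * ?A = 1\<^sub>m (dim_row B)"
    by (auto simp: invertible_mat_def inverts_mat_def)
  have "dim_col (?A * B) = n" "dim_col (B * ?A) = dim_row B" by (simp_all add: B)
  then have Bc: "B \<in> carrier_mat n n" by auto
  have "\<exists>x\<in>carrier_vec n. T *\<^sub>v x = y" if y: "y \<in> carrier_vec m" for y
  proof
    let ?z = "y @\<^sub>v 0\<^sub>v (n - m)"
    have z: "?z \<in> carrier_vec n" using y len by (intro carrier_vecI) (simp add: carrier_vecD)
    show "B *\<^sub>v ?z \<in> carrier_vec n" using Bc z by simp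
    have "?A *\<^sub>v (B *\<^sub>v ?z) = ?A * B *\<^sub>v ?z" using A Bc z by simp
    also have "\<dots> = ?z" using z by (simp add: B)
    finally have eq: "?A *\<^sub>v (B *\<^sub>v ?z) = ?z" .
    show "T *\<^sub>v (B *\<^sub>v ?z) = y"
    proof (rule eq_vecI)
      fix i assume "i < dim_vec y"
      then have i: "i < m" using y by simp
      have "row ?A i = row T i"
        using i T len us rows_carrier[of T]
        by (subst mat_of_rows_row) (auto simp: nth_append)
      then have "(T *\<^sub>v (B *\<^sub>v ?z)) $ i = (?A *\<^sub>v (B *\<^sub>v ?z)) $ i"
        using i T len by simp
      also have "\<dots> = y $ i" using i y by (simp add: eq)
      finally show "(T *\<^sub>v (B *\<^sub>v ?z)) $ i = y $ i" .
    qed (use T y in simp)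
  qed
  then show ?thesis using M.rank_full_iff_surj[OF T] by blast
qed

definition full_rank_mats :: "nat \<Rightarrow> nat \<Rightarrow> 'a::field mat set" where
  "full_rank_mats m n = {T \<in> carrier_mat m n. vec_space.rank m T = m}"

lemma corner_mat_of_rows:
  assumes "T \<in> carrier_mat m n" "m \<le> n"
  shows "corner m (mat_of_rows n (rows T @ us)) = corner m T"
  using assms by (intro eq_matI) (auto simp: corner_def mat_of_rows_index nth_append)

text \<open>Cutting an invertible matrix into its upper \<open>m\<close> and lower \<open>n - m\<close> rows.\<close>
lemma bij_betw_GL_full_rank_mats:
  fixes P :: "'a::{finite,field} mat \<Rightarrow> bool"
  assumes "m \<le> n"
  shows "bij_betw (\<lambda>(T, us). mat_of_rows n (rows T @ us))
     (SIGMA T:{T \<in> full_rank_mats m n. P (corner m T)}.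
        finite_vec_space.extensions n (n - m) (rows T) n)
     {A \<in> GL n. P (corner m A)}"
proof -
  interpret N: finite_vec_space "TYPE('a)" n .
  let ?D = "SIGMA T:{T \<in> full_rank_mats m n. P (corner m T)}. N.extensions (n - m) (rows T) n"
  let ?top = "\<lambda>A. mat_of_rows n (take m (rows A))"
  have GL_rows: "mat_of_rows n (rows T @ us) \<in> GL n \<longleftrightarrow> N.list_rank (us @ rows T) = n"
    if "T \<in> carrier_mat m n" "length us = n - m" "set us \<subseteq> carrier_vec n" for T us
  proof -
    have "set (rows T) \<subseteq> carrier_vec n" using rows_carrier[of T] that by auto
    then have "rows (mat_of_rows n (rows T @ us)) = rows T @ us" using that by simp
    moreover have "mat_of_rows n (rows T @ us) \<in> carrier_mat n n"
      using that assms by (intro carrier_matI) auto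
    moreover have "N.list_rank (rows T @ us) = N.list_rank (us @ rows T)"
      by (rule N.list_rank_cong) (simp add: Un_commute)
    ultimately show ?thesis using GL_iff_list_rank_rows by metis
  qed
  show ?thesis
  proof (rule bij_betwI[where g = "\<lambda>A. (?top A, drop m (rows A))"])
    show "(\<lambda>(T, us). mat_of_rows n (rows T @ us)) \<in> ?D \<rightarrow> {A \<in> GL n. P (corner m A)}"
      using GL_rows assms
      by (auto simp: full_rank_mats_def N.extensions_def corner_mat_of_rows)
    have split: "rows (?top A) = take m (rows A)" "?top A \<in> carrier_mat m n"
      "mat_of_rows n (rows (?top A) @ drop m (rows A)) = A"
      "length (drop m (rows A)) = n - m" "set (drop m (rows A)) \<subseteq> carrier_vec n"
      if "A \<in> carrier_mat n n" for A :: "'a mat"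
    proof -
      have r: "set (rows A) \<subseteq> carrier_vec n" using rows_carrier[of A] that by auto
      show 1: "rows (?top A) = take m (rows A)"
        using r by (intro rows_mat_of_rows) (meson order_trans set_take_subset)
      show "?top A \<in> carrier_mat m n" using that assms by (intro carrier_matI) auto
      show "mat_of_rows n (rows (?top A) @ drop m (rows A)) = A"
        unfolding 1 append_take_drop_id using that mat_of_rows_rows[of A] by simp
      show "length (drop m (rows A)) = n - m" using that by simp
      show "set (drop m (rows A)) \<subseteq> carrier_vec n"
        using r by (meson order_trans set_drop_subset)
    qed
    show "(\<lambda>A. (?top A, drop m (rows A))) \<in> {A \<in> GL n. P (corner m A)} \<rightarrow> ?D"
    proof (rule Pi_I)
      fix A assume A: "A \<in> {A \<in> GL n. P (corner m A)}"
      then have c: "A \<in> carrier_mat n n" by (simp add: GL_def)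
      note s = split[OF c]
      have "?top A \<in> full_rank_mats m n"
        using full_row_rank_of_GL[OF s(2,4) assms s(5)] s A by (simp add: full_rank_mats_def)
      moreover have "corner m (?top A) = corner m A"
        using corner_mat_of_rows[OF s(2) assms, of "drop m (rows A)"] s(3) by simp
      moreover have "drop m (rows A) \<in> N.extensions (n - m) (rows (?top A)) n"
        using GL_rows[OF s(2,4,5)] s(3,4,5) A by (simp add: N.extensions_def)
      ultimately show "(?top A, drop m (rows A)) \<in> ?D" using A by simp
    qed
    show "(\<lambda>A. (?top A, drop m (rows A))) ((\<lambda>(T, us). mat_of_rows n (rows T @ us)) p) = p"
      if p: "p \<in> ?D" for p
    proof (cases p)
      case (Pair T us)
      have T: "T \<in> carrier_mat m n" and us: "set us \<subseteq> carrier_vec n"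
        using p Pair by (auto simp: full_rank_mats_def N.extensions_def)
      have "rows (mat_of_rows n (rows T @ us)) = rows T @ us"
        using T us rows_carrier[of T] by (intro rows_mat_of_rows) auto
      then show ?thesis using T mat_of_rows_rows[of T] by (simp add: Pair)
    qed
    show "(\<lambda>(T, us). mat_of_rows n (rows T @ us)) ((\<lambda>A. (?top A, drop m (rows A))) A) = A"
      if "A \<in> {A \<in> GL n. P (corner m A)}" for A
      using split(3)[of A] that by (simp add: GL_def)
  qed
qed

text \<open>
  The number \<open>c\<close> of completions depends on an upper rectangle only through the rank \<open>m\<close> of its rows,
  by the count of extensions.
\<close>
lemma card_GL_corner:
  fixes P :: "'a::{finite,field} mat \<Rightarrow> bool"
  assumes "m \<le> n"
  obtains c where "\<And>P. card {A \<in> GL n :: 'a mat set. P (corner m A)} =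
      c * card {T \<in> full_rank_mats m n. P (corner m T)}"
proof
  interpret N: finite_vec_space "TYPE('a)" n .
  fix P :: "'a mat \<Rightarrow> bool"
  let ?S = "{T \<in> full_rank_mats m n. P (corner m T)}"
  have c: "card (N.extensions (n - m) (rows T) n) =
      CARD('a) ^ (m * (n - m)) * gauss_binomial CARD('a) (n - m) (n - m) *
      num_frames CARD('a) (n - m) (n - m)" if T: "T \<in> ?S" for T
  proof -
    have "T \<in> carrier_mat m n" "vec_space.rank m T = m"
      using T by (auto simp: full_rank_mats_def)
    then have "N.list_rank (rows T) = m" "set (rows T) \<subseteq> carrier_vec n"
      using rank_transpose_of_full_row_rank[of T m n] rows_carrier[of T]
      by (auto simp: N.rank_eq_list_rank)
    then show ?thesis using N.card_extensions[of "rows T" "n - m" "n - m"] assms by simp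
  qed
  have fin: "finite ?S"
  proof (rule finite_subset)
    show "?S \<subseteq> mat_of_rows n ` {xs. set xs \<subseteq> carrier_vec n \<and> length xs = m}"
    proof
      fix T assume "T \<in> ?S"
      then have "T \<in> carrier_mat m n" by (simp add: full_rank_mats_def)
      then show "T \<in> mat_of_rows n ` {xs. set xs \<subseteq> carrier_vec n \<and> length xs = m}"
        using rows_carrier[of T] mat_of_rows_rows[of T] by (intro image_eqI[of _ _ "rows T"]) auto
    qed
  qed (intro finite_imageI finite_lists_length_eq finite_carrier_vec)
  have "card {A \<in> GL n. P (corner m A)} =
      card (SIGMA T:?S. N.extensions (n - m) (rows T) n)"
    using bij_betw_same_card[OF bij_betw_GL_full_rank_mats[OF assms, of P]] by simp
  also have "\<dots> = CARD('a) ^ (m * (n - m)) * gauss_binomial CARD('a) (n - m) (n - m) *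
      num_frames CARD('a) (n - m) (n - m) * card ?S"
    using c by (subst card_SigmaI) (auto simp: fin N.finite_extensions)
  finally show "card {A \<in> GL n. P (corner m A)} =
      CARD('a) ^ (m * (n - m)) * gauss_binomial CARD('a) (n - m) (n - m) *
      num_frames CARD('a) (n - m) (n - m) * card ?S" .
qed

section \<open>Counting full-rank matrices by the corank of a corner\<close>

lemma card_full_rank_mats:
  "card (full_rank_mats m n :: 'a::{finite,field} mat set) =
     gauss_binomial CARD('a) n m * num_frames CARD('a) m m"
proof -
  interpret M: finite_vec_space "TYPE('a)" m .
  have "bij_betw (mat_of_cols m) (M.extensions n [] m) (full_rank_mats m n)"
  proof (rule bij_betwI[where g = cols])
    show "mat_of_cols m \<in> M.extensions n [] m \<rightarrow> full_rank_mats m n"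
      by (auto simp: M.extensions_def full_rank_mats_def M.rank_eq_list_rank intro!: carrier_matI)
    show "cols \<in> full_rank_mats m n \<rightarrow> M.extensions n [] m"
    proof (rule Pi_I)
      fix T :: "'a mat" assume T: "T \<in> full_rank_mats m n"
      then have "dim_row T = m" by (auto simp: full_rank_mats_def)
      with T show "cols T \<in> M.extensions n [] m"
        using cols_dim[of T] by (auto simp: M.extensions_def full_rank_mats_def M.rank_eq_list_rank)
    qed
    show "mat_of_cols m (cols T) = T" if "T \<in> full_rank_mats m n" for T :: "'a mat"
    proof -
      have "dim_row T = m" using that by (auto simp: full_rank_mats_def)
      then show ?thesis using mat_of_cols_cols[of T] by simp
    qed
  qed (simp add: M.extensions_def)
  then have "card (full_rank_mats m n :: 'a mat set) = card (M.extensions n [] m)"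
    by (rule bij_betw_same_card[symmetric])
  then show ?thesis
    using M.card_extensions[of "[]" n m] by (simp add: M.list_rank_Nil)
qed

text \<open>
  The first factor counts the corners of rank \<open>m - k\<close>, column by column; the second counts the lists of
  \<open>n - m\<close> further columns that fill up the remaining \<open>k\<close> dimensions.
\<close>
lemma card_full_rank_mats_corank:
  assumes "k \<le> m" "m \<le> n"
  shows "card {T \<in> full_rank_mats m n :: 'a::{finite,field} mat set. corank (corner m T) = k} =
    gauss_binomial CARD('a) m (m - k) * num_frames CARD('a) m (m - k) *
    (CARD('a) ^ ((m - k) * (n - m)) * gauss_binomial CARD('a) (n - m) k * num_frames CARD('a) k k)"
proof -
  interpret M: finite_vec_space "TYPE('a)" m .
  let ?L = "M.extensions m [] (m - k)"
  let ?D = "SIGMA ws:?L. M.extensions (n - m) ws m"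
  let ?S = "{T \<in> full_rank_mats m n :: 'a mat set. corank (corner m T) = k}"
  have corner: "corner m (mat_of_cols m (ws @ us)) = mat_of_cols m ws"
    if "length ws = m" for ws us :: "'a vec list"
    using that by (intro eq_matI) (auto simp: corner_def mat_of_cols_index nth_append)
  have corank: "corank (mat_of_cols m ws) = k \<longleftrightarrow> M.list_rank ws = m - k"
    if "set ws \<subseteq> carrier_vec m" for ws
    using that M.list_rank_le[OF that] assms(1)
    by (auto simp: corank_def M.rank_eq_list_rank)
  have comm: "M.list_rank (us @ ws) = M.list_rank (ws @ us)" for us ws
    by (rule M.list_rank_cong) (simp add: Un_commute)
  have "bij_betw (\<lambda>(ws, us). mat_of_cols m (ws @ us)) ?D ?S"
  proof (rule bij_betwI[where g = "\<lambda>T. (take m (cols T), drop m (cols T))"])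
    show "(\<lambda>(ws, us). mat_of_cols m (ws @ us)) \<in> ?D \<rightarrow> ?S"
    proof (rule Pi_I)
      fix p assume "p \<in> ?D"
      then obtain ws us where p: "p = (ws, us)" and ws: "length ws = m" "set ws \<subseteq> carrier_vec m"
        "M.list_rank ws = m - k" and us: "length us = n - m" "set us \<subseteq> carrier_vec m"
        "M.list_rank (us @ ws) = m"
        by (auto simp: M.extensions_def)
      have "mat_of_cols m (ws @ us) \<in> full_rank_mats m n"
        using ws us assms comm[of us ws]
        by (auto simp: full_rank_mats_def M.rank_eq_list_rank intro!: carrier_matI)
      then show "(\<lambda>(ws, us). mat_of_cols m (ws @ us)) p \<in> ?S"
        using ws corank[OF ws(2)] by (simp add: p corner)
    qed
    show "(\<lambda>T. (take m (cols T), drop m (cols T))) \<in> ?S \<rightarrow> ?D"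
    proof (rule Pi_I)
      fix T assume T: "T \<in> ?S"
      then have c: "T \<in> carrier_mat m n" and r: "M.list_rank (cols T) = m"
        by (auto simp: full_rank_mats_def M.rank_eq_list_rank)
      have s: "set (cols T) \<subseteq> carrier_vec m" using c cols_dim[of T] by simp
      have s': "set (take m (cols T)) \<subseteq> carrier_vec m" "set (drop m (cols T)) \<subseteq> carrier_vec m"
        using s by (meson order_trans set_take_subset set_drop_subset)+
      have "corner m T = mat_of_cols m (take m (cols T))"
        using corner[of "take m (cols T)" "drop m (cols T)"] c assms mat_of_cols_cols[of T] by simp
      then have "M.list_rank (take m (cols T)) = m - k"
        using T corank[OF s'(1)] by simp
      then show "(take m (cols T), drop m (cols T)) \<in> ?D"
        using s' r c assms comm[of "drop m (cols T)" "take m (cols T)"]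
        by (simp add: M.extensions_def)
    qed
    show "(\<lambda>T. (take m (cols T), drop m (cols T))) ((\<lambda>(ws, us). mat_of_cols m (ws @ us)) p) = p"
      if "p \<in> ?D" for p
      using that by (auto simp: M.extensions_def)
    show "(\<lambda>(ws, us). mat_of_cols m (ws @ us)) ((\<lambda>T. (take m (cols T), drop m (cols T))) T) = T"
      if "T \<in> ?S" for T
    proof -
      have "dim_row T = m" using that by (auto simp add: full_rank_mats_def)
      then show ?thesis using mat_of_cols_cols[of T] by simp
    qed
  qed
  then have "card ?S = card ?D" by (rule bij_betw_same_card[symmetric])
  also have "\<dots> = (\<Sum>ws\<in>?L. card (M.extensions (n - m) ws m))"
    by (subst card_SigmaI) (auto simp: M.finite_extensions)
  also have "\<dots> = (\<Sum>ws\<in>?L. CARD('a) ^ ((m - k) * (n - m)) *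
      gauss_binomial CARD('a) (n - m) k * num_frames CARD('a) k k)"
  proof (rule sum.cong)
    fix ws assume "ws \<in> ?L"
    then have "set ws \<subseteq> carrier_vec m" "M.list_rank ws = m - k"
      by (auto simp: M.extensions_def)
    then show "card (M.extensions (n - m) ws m) = CARD('a) ^ ((m - k) * (n - m)) *
        gauss_binomial CARD('a) (n - m) k * num_frames CARD('a) k k"
      using M.card_extensions[of ws "n - m" k] assms by simp
  qed simp
  also have "\<dots> = card ?L * (CARD('a) ^ ((m - k) * (n - m)) *
      gauss_binomial CARD('a) (n - m) k * num_frames CARD('a) k k)"
    by simp
  also have "card ?L = gauss_binomial CARD('a) m (m - k) * num_frames CARD('a) m (m - k)"
    using M.card_extensions[of "[]" m "m - k"] by (simp add: M.list_rank_Nil)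
  finally show ?thesis .
qed

section \<open>The corank distribution and its limit\<close>

text \<open>
  One-sided domination of the point masses suffices: on a set \<open>B\<close> it bounds how far \<open>X\<close> exceeds \<open>Y\<close>,
  and \<open>Y\<close> exceeds \<open>X\<close> on \<open>B\<close> by as much as \<open>X\<close> exceeds \<open>Y\<close> on the complement of \<open>B\<close>.
\<close>
lemma tv_dist_le:
  fixes X Y :: "'b pmf"
  assumes le: "\<And>k. pmf X k \<le> (1 + \<delta>) * pmf Y k" and \<delta>: "0 \<le> \<delta>"
  shows "tv_dist X Y \<le> \<delta>"
proof -
  have up: "measure_pmf.prob X B - measure_pmf.prob Y B \<le> \<delta>" for B
  proof -
    have "measure_pmf.prob X B = infsetsum (pmf X) B" by (rule measure_pmf_conv_infsetsum)
    also have "\<dots> \<le> infsetsum (\<lambda>k. (1 + \<delta>) * pmf Y k) B"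
      by (intro infsetsum_mono le abs_summable_on_cmult_right pmf_abs_summable)
    also have "\<dots> = (1 + \<delta>) * measure_pmf.prob Y B"
      by (subst infsetsum_cmult_right) (auto simp: measure_pmf_conv_infsetsum pmf_abs_summable)
    also have "\<dots> \<le> measure_pmf.prob Y B + \<delta>"
      using mult_left_mono[OF measure_pmf.prob_le_1[of Y B] \<delta>] by (simp add: algebra_simps)
    finally show ?thesis by simp
  qed
  have "measure_pmf.prob Y B - measure_pmf.prob X B \<le> \<delta>" for B
    using up[of "- B"] measure_pmf.prob_compl[of B X] measure_pmf.prob_compl[of B Y]
    by (simp add: Compl_eq_Diff_UNIV)
  with up show ?thesis
    unfolding tv_dist_def by (intro cSUP_least) (auto simp: abs_le_iff)
qed

lemma tv_dist_le_1: "tv_dist X Y \<le> 1"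
  unfolding tv_dist_def
proof (rule cSUP_least)
  fix B
  show "\<bar>measure_pmf.prob X B - measure_pmf.prob Y B\<bar> \<le> 1"
    using measure_pmf.prob_le_1[of X B] measure_pmf.prob_le_1[of Y B]
      measure_nonneg[of "measure_pmf X" B] measure_nonneg[of "measure_pmf Y" B] by linarith
qed simp

text \<open>
  The number of completions of an upper rectangle cancels, and so do all factors \<open>num_frames\<close>. What is left is
  the q-Vandermonde distribution, a product of two Gaussian binomial coefficients over a third, up to a
  power of \<open>q\<close>.
\<close>
lemma pmf_corank_corner_GL:
  defines "x \<equiv> 1 / real CARD('a::{finite,field})"
  shows "pmf (map_pmf (\<lambda>A. corank (corner m A)) (pmf_of_set (GL (m + d) :: 'a mat set))) k =
    (if k \<le> m \<and> k \<le> d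
     then x ^ k\<^sup>2 * (qpoch x m)\<^sup>2 * (qpoch x d)\<^sup>2 /
       ((qpoch x k)\<^sup>2 * qpoch x (m - k) * qpoch x (d - k) * qpoch x (m + d))
     else 0)"
    (is "pmf ?X k = ?rhs")
proof -
  let ?q = "CARD('a)"
  have q: "?q \<ge> 2" by (rule card_field_ge_2)
  then have x: "0 < x" "x < 1" by (auto simp: x_def)
  let ?S = "{T \<in> full_rank_mats m (m + d) :: 'a mat set. corank (corner m T) = k}"
  obtain c where c: "\<And>P. card {A \<in> GL (m + d) :: 'a mat set. P (corner m A)} =
      c * card {T \<in> full_rank_mats m (m + d). P (corner m T)}"
    using card_GL_corner[of m "m + d", where 'a = 'a] by auto
  have GL: "card (GL (m + d) :: 'a mat set) = c * card (full_rank_mats m (m + d) :: 'a mat set)"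
    using c[of "\<lambda>_. True"] by simp
  have "card (GL (m + d) :: 'a mat set) > 0"
    by (simp add: card_gt_0_iff GL_nonempty finite_GL)
  then have c0: "c \<noteq> 0" using GL by (intro notI) simp
  have "pmf ?X k = card {A \<in> GL (m + d) :: 'a mat set. corank (corner m A) = k} /
      card (GL (m + d) :: 'a mat set)"
    unfolding pmf_map by (subst measure_pmf_of_set[OF GL_nonempty finite_GL])
      (simp add: vimage_def Collect_conj_eq)
  also have "\<dots> = real (card ?S) / card (full_rank_mats m (m + d) :: 'a mat set)"
    using c0 c[of "\<lambda>M. corank M = k"] by (simp add: GL)
  finally have pmf: "pmf ?X k = real (card ?S) / card (full_rank_mats m (m + d) :: 'a mat set)" .
  show ?thesis
  proof (cases "k \<le> m")
    case False
    then have "?S = {}" by (auto simp: corank_def corner_def)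
    then show ?thesis using False by (simp only: pmf) simp
  next
    case km: True
    note S = card_full_rank_mats_corank[OF km, of "m + d", where 'a = 'a, simplified]
    show ?thesis
    proof (cases "k \<le> d")
      case False
      then have "card ?S = 0" by (simp add: S gauss_binomial_eq_0)
      then show ?thesis using False by (simp add: pmf)
    next
      case kd: True
      define a b where "a = m - k" and "b = d - k"
      have m: "m = a + k" and d: "d = k + b" using km kd by (auto simp: a_def b_def)
      define F G where "F = real (num_frames ?q m a)" and "G = real (num_frames ?q k k)"
      have FG: "F > 0" "G > 0" using num_frames_pos[OF q] by (auto simp: F_def G_def m)
      have ph: "qpoch x i > 0" for i using qpoch_pos[OF x] .
      have num: "real (card ?S) =
          (real ?q ^ (a * k) * qpoch x m / (qpoch x a * qpoch x k)) * F *
          (real ?q ^ (a * d) * (real ?q ^ (k * b) * qpoch x d / (qpoch x k * qpoch x b)) * G)"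
        using S gauss_binomial_eq_qpoch[OF q, of a k] gauss_binomial_eq_qpoch[OF q, of k b]
        unfolding a_def[symmetric] F_def G_def x_def m[symmetric] d[symmetric] by simp
      have den: "real (card (full_rank_mats m (m + d) :: 'a mat set)) =
          (real ?q ^ (m * d) * qpoch x (m + d) / (qpoch x m * qpoch x d)) *
          (F * (real ?q ^ (a * k) * G))"
        using gauss_binomial_eq_qpoch[OF q, of m d] num_frames_split[OF km, of ?q]
        by (simp add: card_full_rank_mats F_def G_def x_def a_def)
      have powers: "real ?q ^ (a * d) * real ?q ^ (k * b) = x ^ k\<^sup>2 * real ?q ^ (m * d)"
      proof -
        have "m * d = k\<^sup>2 + (a * d + k * b)"
          by (simp add: m d algebra_simps power2_eq_square)
        then have "real ?q ^ (m * d) = real ?q ^ k\<^sup>2 * (real ?q ^ (a * d) * real ?q ^ (k * b))"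
          by (simp add: power_add)
        then show ?thesis using q by (simp add: x_def power_one_over)
      qed
      have cancel: "(A * pm / (pa * pk)) * F * (B * (C * pd / (pk * pb)) * G) /
          ((D * pmd / (pm * pd)) * (F * (A * G))) =
          Y * pm\<^sup>2 * pd\<^sup>2 / (pk\<^sup>2 * pa * pb * pmd)"
        if "B * C = Y * D" "A > 0" "D > 0" "pm > 0" "pd > 0" "pk > 0" "pa > 0" "pb > 0" "pmd > 0"
        for A B C D Y pm pd pk pa pb pmd :: real
      proof -
        have "(A * pm / (pa * pk)) * F * (B * (C * pd / (pk * pb)) * G) /
            ((D * pmd / (pm * pd)) * (F * (A * G))) = (B * C) * pm\<^sup>2 * pd\<^sup>2 / (D * (pk\<^sup>2 * pa * pb * pmd))"
          using that(2-) FG by (simp add: divide_simps power2_eq_square)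
        then show ?thesis using that by simp
      qed
      have "?rhs = x ^ k\<^sup>2 * (qpoch x m)\<^sup>2 * (qpoch x d)\<^sup>2 /
          ((qpoch x k)\<^sup>2 * qpoch x a * qpoch x b * qpoch x (m + d))"
        using km kd by (simp add: a_def b_def)
      moreover have "pmf ?X k = \<dots>"
        unfolding pmf num den by (rule cancel[OF powers]) (use q ph in auto)
      ultimately show ?thesis by simp
    qed
  qed
qed

text \<open>
  The bound is trivial unless \<open>s = x ^ m + x ^ d\<close> is below \<open>1 / 3\<close>. Then
  \<open>1 / ((1 - x ^ m) * (1 - x ^ d)) \<le> 1 / (1 - s) \<le> 1 + 3 * s\<close> bounds the ratio of the point masses.
\<close>
lemma tv_dist_corank_corner_le:
  defines "x \<equiv> 1 / real CARD('a::{finite,field})"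
  shows "tv_dist (map_pmf (\<lambda>A. corank (corner m A)) (pmf_of_set (GL (m + d) :: 'a mat set)))
      (Q_infty CARD('a)) \<le> 3 * (x ^ m + x ^ d)"
    (is "tv_dist ?X ?Y \<le> _")
proof (cases "3 * (x ^ m + x ^ d) \<ge> 1")
  case True
  then show ?thesis using tv_dist_le_1[of ?X ?Y] by linarith
next
  case False
  have q: "CARD('a) \<ge> 2" by (rule card_field_ge_2)
  then have x: "0 < x" "x \<le> 1 / 2" "x < 1" by (auto simp: x_def field_simps)
  define u v where "u = x ^ m" and "v = x ^ d"
  define s where "s = u + v"
  have uv: "0 < u" "0 < v" "s < 1 / 3" using False x by (auto simp: u_def v_def s_def)
  define P where "P = (\<Prod>i. 1 - x ^ Suc i)"
  have ph: "qpoch x i > 0" for i using qpoch_pos[of x i] x by simp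
  have P: "0 < P"
    unfolding P_def using power_Suc_less_one[of x] x
    by (intro less_0_prodinf convergent_prod_qpoch) auto
  have s: "1 \<le> (1 - u) * (1 - v) * (1 + 3 * s)"
  proof -
    have "1 - s \<le> (1 - u) * (1 - v)" using uv by (simp add: s_def algebra_simps)
    then have "(1 - s) * (1 + 3 * s) \<le> (1 - u) * (1 - v) * (1 + 3 * s)"
      using uv by (intro mult_right_mono) (auto simp: s_def)
    moreover have "0 \<le> s * (2 - 3 * s)" using uv by (intro mult_nonneg_nonneg) (auto simp: s_def)
    ultimately show ?thesis by (simp add: algebra_simps)
  qed
  have key: "qpoch x m * qpoch x d \<le> (1 + 3 * s) * (P * qpoch x (m + d))"
  proof -
    have "qpoch x m * qpoch x d * 1 \<le> qpoch x m * qpoch x d * ((1 - u) * (1 - v) * (1 + 3 * s))"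
      using s ph[of m] ph[of d] by (intro mult_left_mono) auto
    also have "\<dots> = (1 + 3 * s) * ((qpoch x m * (1 - u)) * (qpoch x d * (1 - v)))"
      by (simp add: algebra_simps)
    also have "\<dots> \<le> (1 + 3 * s) * (P * qpoch x (m + d))"
    proof (intro mult_left_mono mult_mono)
      show "qpoch x m * (1 - u) \<le> P"
        unfolding u_def P_def by (rule qpoch_limit_ge[OF x(1,2)])
      show "qpoch x d * (1 - v) \<le> qpoch x (m + d)"
        unfolding v_def using qpoch_add_ge[OF x(1,2), of d m] by (simp add: add.commute)
      show "0 \<le> qpoch x d * (1 - v)" using ph[of d] uv by (auto simp: s_def)
    qed (use P uv in \<open>auto simp: s_def\<close>)
    finally show ?thesis by simp
  qed
  have "tv_dist ?X ?Y \<le> 3 * s"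
  proof (rule tv_dist_le)
    show "0 \<le> 3 * s" using uv by (simp add: s_def)
    fix k
    have Y: "pmf ?Y k = x ^ k\<^sup>2 * P / (qpoch x k)\<^sup>2"
      using pmf_Q_infty[OF q, of k] Q_infty_mass_eq[OF q, of k] by (simp add: x_def P_def)
    show "pmf ?X k \<le> (1 + 3 * s) * pmf ?Y k"
    proof (cases "k \<le> m \<and> k \<le> d")
      case False
      then show ?thesis
        using pmf_corank_corner_GL[of m d k, where 'a = 'a] uv pmf_nonneg[of ?Y k]
        by (auto simp: s_def)
    next
      case True
      define w where "w = x ^ k\<^sup>2 / (qpoch x k)\<^sup>2"
      have w: "0 < w" using x ph[of k] by (simp add: w_def)
      have "pmf ?X k = w * ((qpoch x m / qpoch x (m - k)) * (qpoch x d / qpoch x (d - k))) *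
          (qpoch x m * qpoch x d / qpoch x (m + d))"
        using pmf_corank_corner_GL[of m d k, where 'a = 'a] True
        by (simp add: x_def w_def power2_eq_square mult_ac)
      also have "\<dots> \<le> w * (1 * 1) * ((1 + 3 * s) * P)"
      proof (intro mult_mono mult_left_mono)
        show "qpoch x m / qpoch x (m - k) \<le> 1" "qpoch x d / qpoch x (d - k) \<le> 1"
          using ph[of "m - k"] ph[of "d - k"] x qpoch_antimono[of x] by auto
        show "qpoch x m * qpoch x d / qpoch x (m + d) \<le> (1 + 3 * s) * P"
          using key ph[of "m + d"] by (simp add: divide_le_eq mult_ac)
      qed (use ph w less_imp_le in \<open>auto intro!: mult_nonneg_nonneg divide_nonneg_nonneg\<close>)
      also have "\<dots> = (1 + 3 * s) * pmf ?Y k" by (simp add: Y w_def)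
      finally show ?thesis .
    qed
  qed
  then show ?thesis by (simp add: s_def u_def v_def)
qed

theorem theorem1p16:
  fixes q n n' :: nat and \<epsilon> :: real
  assumes "q = CARD('a::{finite,field})"
    and "\<epsilon> > 0"
    and "n \<ge> 1"
    and "n' \<ge> 1"
    and "real n' \<le> (1 - \<epsilon>) * real n"
  shows "tv_dist
           (map_pmf (\<lambda>A. corank (corner n' A)) (pmf_of_set (GL n :: 'a mat set)))
           (Q_infty q)
         \<le> 3 / real q ^ n' +
           2 powr (min (real n') (\<epsilon> * real n) + 1) / real q powr (\<epsilon> * real n)"
proof -
  define t where "t = \<epsilon> * real n"
  define d where "d = n - n'"
  have t: "0 < t" and nt: "real n' + t \<le> real n"
    using assms by (auto simp: t_def algebra_simps)
  then have n: "n = n' + d" and td: "t \<le> real d" by (auto simp: d_def)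
  have d: "d \<ge> 1" using t td by simp
  have q: "real q \<ge> 2" using card_field_ge_2[where 'a = 'a] assms(1) by simp
  \<comment> \<open>For \<open>t \<le> n'\<close> the right-hand side decreases to its value at \<open>t = d\<close>, which exceeds the left-hand side
    as \<open>2 * 2 ^ d \<ge> 4\<close>. For larger \<open>t\<close> the bound \<open>2 * 2 ^ n' \<ge> 4\<close> on the numerator is enough.\<close>
  have "3 / real q ^ d \<le> 2 powr (min (real n') t + 1) / real q powr t"
  proof (cases "t \<le> real n'")
    case True
    have "(3::real) \<le> 2 * 2 powr real d"
      using d power_increasing[of 1 d "2 :: real"] by (simp add: powr_realpow)
    then have "3 / real q ^ d \<le> 2 * 2 powr real d / real q powr real d"
      using q by (simp add: powr_realpow divide_right_mono)
    also have "\<dots> = 2 * (2 / real q) powr real d"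
      using q by (simp add: powr_divide)
    also have "\<dots> \<le> 2 * (2 / real q) powr t"
      using q td by (intro mult_left_mono powr_mono') auto
    also have "\<dots> = 2 powr (t + 1) / real q powr t"
      using q by (simp add: powr_divide powr_add)
    finally show ?thesis using True by (simp add: min_absorb2)
  next
    case False
    have "(2::real) powr 1 \<le> 2 powr real n'" using assms(4) by (intro powr_mono) auto
    then have "3 / real q ^ d \<le> 2 * 2 powr real n' / real q powr t"
      using q td powr_mono[of t "real d" "real q"]
      by (intro frac_le) (auto simp: powr_realpow)
    then show ?thesis using False by (simp add: min_absorb1 powr_add mult.commute)
  qed
  moreover have "tv_dist (map_pmf (\<lambda>A. corank (corner n' A)) (pmf_of_set (GL n :: 'a mat set)))
      (Q_infty q) \<le> 3 / real q ^ n' + 3 / real q ^ d"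
    using tv_dist_corank_corner_le[of n' d, where 'a = 'a] assms(1)
    by (simp add: n power_one_over distrib_left)
  ultimately show ?thesis by (simp add: t_def)
qed

end
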